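(* Let $(W,S)$ be a finite Coxeter system with $S=\{s_1,\ldots,s_n\}$ (the $s_i$ pairwise distinct, $n=|S|$), and let $c=s_1s_2\cdots s_n$. Then the set of reflections $T=\bigcup_{w\in W}wSw^{-1}$ of $(W,S)$ is equal to $$\{c^k s_1s_2\cdots s_{i-1}s_is_{i-1}\cdots s_1c^{-k}\mid k\in\mathbb{N},\ 1\leq i\leq n\}.$$
   Context: $\mathbb{N}$ denotes the non-negative integers. For $i=1$ the element $s_1\cdots s_i s_{i-1}\cdots s_1$ is just $s_1$. *)

theory Defs
  imports "HOL-Algebra.Generated_Groups"
begin

definition list_mult :: "('a, 'b) monoid_scheme \<Rightarrow> 'a list \<Rightarrow> 'a" where
  "list_mult G xs = foldr (mult G) xs (one G)"

text \<open>Group words over an alphabet: the letter \<open>(x, True)\<close> stands for the generator \<open>x\<close> and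
  \<open>(x, False)\<close> for its formal inverse.\<close>

type_synonym 'a gword = "('a \<times> bool) list"

definition eval_gword :: "('a, 'b) monoid_scheme \<Rightarrow> 'a gword \<Rightarrow> 'a" where
  "eval_gword G u = list_mult G (map (\<lambda>(x, b). if b then x else m_inv G x) u)"

text \<open>Two words over \<open>S\<close> are related iff they represent the same element of the abstract group
  with generators \<open>S\<close> and relators \<open>R\<close>, i.e. of the free group on \<open>S\<close> modulo the normal closure
  of \<open>R\<close>.\<close>

inductive gword_eq :: "'a set \<Rightarrow> 'a gword set \<Rightarrow> 'a gword \<Rightarrow> 'a gword \<Rightarrow> bool"
  for S :: "'a set" and R :: "'a gword set" where
  refl: "gword_eq S R u u"
| sym: "gword_eq S R u v \<Longrightarrow> gword_eq S R v u"
| trans: "gword_eq S R u v \<Longrightarrow> gword_eq S R v w \<Longrightarrow> gword_eq S R u w"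
| cancel: "x \<in> S \<Longrightarrow> gword_eq S R (u @ [(x, b), (x, \<not> b)] @ v) (u @ v)"
| relator: "r \<in> R \<Longrightarrow> gword_eq S R (u @ r @ v) (u @ v)"

text \<open>\<open>G\<close> is presented by \<open>\<langle>S | R\<rangle>\<close>: the canonical map from the free group on \<open>S\<close> to \<open>G\<close> is
  onto and its kernel is the normal closure of \<open>R\<close>.\<close>

definition has_presentation ::
    "('a, 'b) monoid_scheme \<Rightarrow> 'a set \<Rightarrow> 'a gword set \<Rightarrow> bool" where
  "has_presentation G S R \<longleftrightarrow>
     group G \<and> S \<subseteq> carrier G \<and> generate G S = carrier G \<and>
     (\<forall>u \<in> lists (S \<times> UNIV). eval_gword G u = one G \<longleftrightarrow> gword_eq S R u [])"

text \<open>The entry \<open>0\<close> of a Coxeter matrix encodes \<open>\<infinity>\<close>; the corresponding relator is then the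
  empty word, so that it imposes no relation.\<close>

definition coxeter_matrix :: "'a set \<Rightarrow> ('a \<Rightarrow> 'a \<Rightarrow> nat) \<Rightarrow> bool" where
  "coxeter_matrix S m \<longleftrightarrow>
     (\<forall>x\<in>S. m x x = 1) \<and>
     (\<forall>x\<in>S. \<forall>y\<in>S. m x y = m y x) \<and>
     (\<forall>x\<in>S. \<forall>y\<in>S. x \<noteq> y \<longrightarrow> m x y = 0 \<or> m x y \<ge> 2)"

definition coxeter_relators :: "'a set \<Rightarrow> ('a \<Rightarrow> 'a \<Rightarrow> nat) \<Rightarrow> 'a gword set" where
  "coxeter_relators S m =
     {concat (replicate (m x y) [(x, True), (y, True)]) | x y. x \<in> S \<and> y \<in> S}"

definition coxeter_system :: "('a, 'b) monoid_scheme \<Rightarrow> 'a set \<Rightarrow> bool" where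
  "coxeter_system W S \<longleftrightarrow>
     (\<exists>m. coxeter_matrix S m \<and> has_presentation W S (coxeter_relators S m))"

definition reflections :: "('a, 'b) monoid_scheme \<Rightarrow> 'a set \<Rightarrow> 'a set" where
  "reflections W S = (\<Union>w\<in>carrier W. {w \<otimes>\<^bsub>W\<^esub> x \<otimes>\<^bsub>W\<^esub> inv\<^bsub>W\<^esub> w | x. x \<in> S})"

end

theory Submission
  imports Defs Complex_Main "HOL-Algebra.Multiplicative_Group"
begin

text \<open>Let \<open>W\<close> act on its geometric representation, with simple roots \<open>e\<^sub>s\<close> and roots \<open>w e\<^sub>s\<close>.
  A vector fixed by \<open>c\<close> is fixed by every simple reflection, because the simple roots are linearly
  independent, hence by all of \<open>W\<close>. The sum \<open>v\<close> of a \<open>c\<close>-orbit of a root is therefore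
  equal to its own average over \<open>W\<close>; but a root has average zero, as its reflection negates it.
  So \<open>v = 0\<close>. Since every root is a nonnegative or a nonpositive combination of simple roots, each
  \<open>c\<close>-orbit contains a nonnegative root that \<open>c = s\<^sub>1 \<dots> s\<^sub>n\<close> makes nonpositive. The letter \<open>s\<^sub>i\<close>
  at which the sign changes acts on a multiple of the simple root of \<open>s\<^sub>i\<close>, which exhibits the
  reflection in the original root as a conjugate by a power of \<open>c\<close> of
  \<open>s\<^sub>1 \<dots> s\<^sub>i \<dots> s\<^sub>1\<close>.\<close>

lemma list_mult_Nil [simp]: "list_mult G [] = \<one>\<^bsub>G\<^esub>"
  by (simp add: list_mult_def)

lemma list_mult_Cons [simp]: "list_mult G (x # xs) = x \<otimes>\<^bsub>G\<^esub> list_mult G xs"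
  by (simp add: list_mult_def)

context group
begin

lemma list_mult_closed: "xs \<in> lists (carrier G) \<Longrightarrow> list_mult G xs \<in> carrier G"
  by (induction xs) auto

lemma list_mult_append:
  assumes "xs \<in> lists (carrier G)" "ys \<in> lists (carrier G)"
  shows "list_mult G (xs @ ys) = list_mult G xs \<otimes> list_mult G ys"
  using assms by (induction xs) (auto simp: list_mult_closed m_assoc)

end

section \<open>Alternating words and Chebyshev polynomials\<close>

text \<open>Anchored at the right end: \<open>x\<close> is the last letter, which acts first on a
  vector and which plays the part of a right descent in the length argument.\<close>

fun alternating :: "'a \<Rightarrow> 'a \<Rightarrow> nat \<Rightarrow> 'a list" where
  "alternating x y 0 = []"
| "alternating x y (Suc k) = alternating y x k @ [x]"

lemma length_alternating [simp]: "length (alternating x y k) = k"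
  by (induction k arbitrary: x y) auto

lemma set_alternating: "set (alternating x y k) \<subseteq> {x, y}"
  by (induction k arbitrary: x y) fastforce+

lemma alternating_add:
  "alternating x y (j + k) =
     (if even k then alternating x y j else alternating y x j) @ alternating x y k"
  by (induction k arbitrary: x y) auto

lemma alternating_Cons:
  "alternating x y (Suc k) = (if even k then x else y) # alternating x y k"
  using alternating_add[of x y 1 k] by simp

lemma rev_alternating:
  "rev (alternating x y k) = (if even k then alternating y x k else alternating x y k)"
proof (induction k arbitrary: x y)
  case (Suc k)
  have "rev (alternating x y (Suc k)) = x # rev (alternating y x k)" by simp
  also have "\<dots> = x # (if even k then alternating x y k else alternating y x k)"
    by (simp only: Suc)
  also have "\<dots> = (if even (Suc k) then alternating y x (Suc k) else alternating x y (Suc k))"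
    by (simp only: alternating_Cons even_Suc if_not_P if_P split: if_split) simp
  finally show ?case .
qed simp

text \<open>The values \<open>sin (k \<theta>) / sin \<theta>\<close> at \<open>q = 2 cos \<theta>\<close>, in a form that also covers \<open>q = 2\<close>, i.e.
  a product of two generators without relator.\<close>

fun chebyshev :: "real \<Rightarrow> nat \<Rightarrow> real" where
  "chebyshev q 0 = 0"
| "chebyshev q (Suc 0) = 1"
| "chebyshev q (Suc (Suc k)) = q * chebyshev q (Suc k) - chebyshev q k"

lemma chebyshev_2: "chebyshev 2 k = real k"
  by (induction "2::real" k rule: chebyshev.induct) auto

lemma chebyshev_sin: "sin \<theta> * chebyshev (2 * cos \<theta>) k = sin (real k * \<theta>)"
proof (induction "2 * cos \<theta>" k rule: chebyshev.induct)
  case (3 k)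
  have "sin (real (Suc (Suc k)) * \<theta>) = sin (real (Suc k) * \<theta> + \<theta>)"
    by (simp add: algebra_simps)
  moreover have "sin (real k * \<theta>) = sin (real (Suc k) * \<theta> - \<theta>)"
    by (simp add: algebra_simps)
  ultimately have "sin (real (Suc (Suc k)) * \<theta>) =
      2 * cos \<theta> * sin (real (Suc k) * \<theta>) - sin (real k * \<theta>)"
    by (simp only: sin_add sin_diff) simp
  then show ?case
    using 3 by (simp add: algebra_simps)
qed auto

section \<open>The geometric representation\<close>

definition unit_vec :: "'a \<Rightarrow> 'a \<Rightarrow> real" where
  "unit_vec x = (\<lambda>r. if r = x then 1 else 0)"

locale coxeter = group W for W :: "('a, 'b) monoid_scheme" (structure) +
  fixes S :: "'a set" and m :: "'a \<Rightarrow> 'a \<Rightarrow> nat"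
  assumes matrix: "coxeter_matrix S m"
    and presentation: "has_presentation W S (coxeter_relators S m)"
    and finite_S: "finite S"
begin

text \<open>For \<open>m x y = 0\<close>, which encodes \<open>\<infinity>\<close>, division by zero makes this the intended value \<open>-2\<close>.\<close>

definition cartan :: "'a \<Rightarrow> 'a \<Rightarrow> real" where
  "cartan x y = - 2 * cos (pi / m x y)"

text \<open>Twice the pairing of \<open>v\<close> with the simple root of \<open>x\<close> in the
  usual normalisation. Vectors are functions on the whole type; coordinates outside \<open>S\<close>
  are not read here, and reflections in generators leave them alone.\<close>

definition coroot :: "'a \<Rightarrow> ('a \<Rightarrow> real) \<Rightarrow> real" where
  "coroot x v = (\<Sum>r\<in>S. cartan x r * v r)"

definition refl_map :: "'a \<Rightarrow> ('a \<Rightarrow> real) \<Rightarrow> 'a \<Rightarrow> real" where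
  "refl_map x v = (\<lambda>r. v r - coroot x v * unit_vec x r)"

definition word_act :: "'a list \<Rightarrow> ('a \<Rightarrow> real) \<Rightarrow> 'a \<Rightarrow> real" where
  "word_act xs v = foldr refl_map xs v"

lemma word_act_simps [simp]:
  "word_act [] v = v"
  "word_act (x # xs) v = refl_map x (word_act xs v)"
  "word_act (xs @ ys) v = word_act xs (word_act ys v)"
  by (simp_all add: word_act_def)

lemma S_carrier: "S \<subseteq> carrier W" and generate_S: "generate W S = carrier W"
  using presentation by (auto simp: has_presentation_def)

lemma lists_carrier: "xs \<in> lists S \<Longrightarrow> xs \<in> lists (carrier W)"
  using S_carrier by auto

lemma m_diag: "x \<in> S \<Longrightarrow> m x x = 1"
  and m_sym: "x \<in> S \<Longrightarrow> y \<in> S \<Longrightarrow> m x y = m y x"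
  and m_off_diag: "x \<in> S \<Longrightarrow> y \<in> S \<Longrightarrow> x \<noteq> y \<Longrightarrow> m x y = 0 \<or> m x y \<ge> 2"
  using matrix by (auto simp: coxeter_matrix_def)

lemma cartan_diag: "x \<in> S \<Longrightarrow> cartan x x = 2"
  by (simp add: cartan_def m_diag)

lemma cartan_sym: "x \<in> S \<Longrightarrow> y \<in> S \<Longrightarrow> cartan x y = cartan y x"
  by (simp add: cartan_def m_sym)

lemma coroot_unit_vec: "y \<in> S \<Longrightarrow> coroot x (unit_vec y) = cartan x y"
  using finite_S by (simp add: coroot_def unit_vec_def if_distrib cong: if_cong)

lemma coroot_linear: "coroot x (\<lambda>r. a * v r + b * w r) = a * coroot x v + b * coroot x w"
  by (simp add: coroot_def sum.distrib sum_distrib_left algebra_simps)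

lemma coroot_sum: "coroot x (\<lambda>r. \<Sum>i\<in>I. f i r) = (\<Sum>i\<in>I. coroot x (f i))"
  unfolding coroot_def sum_distrib_left by (rule sum.swap)

lemma refl_map_linear:
  "refl_map x (\<lambda>r. a * v r + b * w r) = (\<lambda>r. a * refl_map x v r + b * refl_map x w r)"
  by (simp add: refl_map_def coroot_linear algebra_simps)

lemma refl_map_sum: "refl_map x (\<lambda>r. \<Sum>i\<in>I. f i r) = (\<lambda>r. \<Sum>i\<in>I. refl_map x (f i) r)"
  by (simp add: refl_map_def coroot_sum sum_subtractf sum_distrib_right)

lemma word_act_linear:
  "word_act xs (\<lambda>r. a * v r + b * w r) = (\<lambda>r. a * word_act xs v r + b * word_act xs w r)"
  by (induction xs) (simp_all add: refl_map_linear)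

lemma word_act_sum: "word_act xs (\<lambda>r. \<Sum>i\<in>I. f i r) = (\<lambda>r. \<Sum>i\<in>I. word_act xs (f i) r)"
  by (induction xs) (simp_all add: refl_map_sum)

lemma word_act_uminus: "word_act xs (\<lambda>r. - v r) = (\<lambda>r. - word_act xs v r)"
  using word_act_linear[of xs "-1" v 0 v] by simp

lemma coroot_refl_map: 
  assumes "x \<in> S" shows "coroot y (refl_map x v) = coroot y v - coroot x v * cartan y x"
  using coroot_linear[of y 1 v "- coroot x v" "unit_vec x"] assms
  by (simp add: refl_map_def coroot_unit_vec algebra_simps)

lemma refl_map_involution: "x \<in> S \<Longrightarrow> refl_map x (refl_map x v) = v"
  using coroot_refl_map[of x x v] unfolding refl_map_def[of x "refl_map x v"]
  by (simp add: cartan_diag refl_map_def fun_eq_iff)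

lemma refl_map_root: "x \<in> S \<Longrightarrow> refl_map x (unit_vec x) = (\<lambda>r. - unit_vec x r)"
  by (simp add: refl_map_def coroot_unit_vec cartan_diag fun_eq_iff)

text \<open>In the plane of two simple roots, reflecting is one step of the Chebyshev recurrence,
  after which the two roots trade places.\<close>

lemma refl_map_plane:
  assumes "x \<in> S" "y \<in> S"
  shows "refl_map y (\<lambda>r. chebyshev (- cartan x y) (Suc j) * unit_vec x r +
             chebyshev (- cartan x y) j * unit_vec y r) =
         (\<lambda>r. chebyshev (- cartan x y) (Suc (Suc j)) * unit_vec y r +
             chebyshev (- cartan x y) (Suc j) * unit_vec x r)"
  using assms
  by (simp add: refl_map_def coroot_linear coroot_unit_vec cartan_diag cartan_sym[of y x])
    (simp add: fun_eq_iff algebra_simps)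

text \<open>The start index \<open>j\<close> is free for the induction: removing the last letter
  raises it by one and swaps \<open>x\<close> and \<open>y\<close>.\<close>

lemma alternating_act:
  assumes "x \<in> S" "y \<in> S"
  shows "word_act (alternating y x k) (\<lambda>r. chebyshev (- cartan x y) (Suc j) * unit_vec x r +
             chebyshev (- cartan x y) j * unit_vec y r) =
         (\<lambda>r. chebyshev (- cartan x y) (Suc (k + j)) * unit_vec (if even k then x else y) r +
             chebyshev (- cartan x y) (k + j) * unit_vec (if even k then y else x) r)"
  using assms
proof (induction k arbitrary: x y j)
  case (Suc k)
  then show ?case
    using Suc.IH[of y x "Suc j"] Suc.prems
    by (simp add: refl_map_plane cartan_sym[of y x] del: chebyshev.simps)
qed simp

lemma alternating_act_root:
  assumes "x \<in> S" "y \<in> S"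
  shows "word_act (alternating y x k) (unit_vec x) =
         (\<lambda>r. chebyshev (- cartan x y) (Suc k) * unit_vec (if even k then x else y) r +
             chebyshev (- cartan x y) k * unit_vec (if even k then y else x) r)"
  using alternating_act[OF assms, of k 0] by simp

lemma alternating_even: "alternating y x (2 * k) = concat (replicate k [x, y])"
proof (induction k)
  case (Suc k)
  have "alternating y x (2 + 2 * k) = alternating y x 2 @ alternating y x (2 * k)"
    by (subst alternating_add) simp
  then show ?case using Suc by (simp add: numeral_2_eq_2)
qed simp

lemma refl_map_fix: "coroot x v = 0 \<Longrightarrow> refl_map x v = v"
  by (simp add: refl_map_def)

lemma word_act_fix: "(\<And>x. x \<in> set xs \<Longrightarrow> coroot x v = 0) \<Longrightarrow> word_act xs v = v"
  by (induction xs) (auto simp: refl_map_fix)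

lemma chebyshev_cartan:
  assumes "x \<in> S" "y \<in> S" "x \<noteq> y" "m x y \<noteq> 0"
  shows "sin (pi / m x y) > 0"
    and "sin (pi / m x y) * chebyshev (- cartan x y) k = sin (real k * (pi / m x y))"
proof -
  have "m x y \<ge> 2" using m_off_diag[of x y] assms by simp
  then have "pi / m x y < pi" "pi / m x y > 0"
    using divide_strict_left_mono[of 1 "real (m x y)" pi] by simp_all
  then show "sin (pi / m x y) > 0" by (rule sin_gt_zero[rotated])
  show "sin (pi / m x y) * chebyshev (- cartan x y) k = sin (real k * (pi / m x y))"
    using chebyshev_sin[of "pi / m x y" k] unfolding cartan_def mult_minus_left minus_minus .
qed

text \<open>For finite \<open>m x y\<close> the angle \<open>k * pi / m x y\<close> has not passed
  \<open>pi\<close>, so its sine is nonnegative; without a relator the value is \<open>k\<close>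
  itself.\<close>

lemma chebyshev_cartan_nonneg:
  assumes "x \<in> S" "y \<in> S" "x \<noteq> y" "m x y = 0 \<or> k \<le> m x y"
  shows "chebyshev (- cartan x y) k \<ge> 0"
proof (cases "m x y = 0")
  case True
  then show ?thesis by (simp add: cartan_def chebyshev_2)
next
  case False
  have "real k * (pi / m x y) \<le> pi"
    using assms(4) False by (simp add: pos_divide_le_eq)
  then have "sin (pi / m x y) * chebyshev (- cartan x y) k \<ge> 0"
    using chebyshev_cartan(2)[OF assms(1-3) False, of k] by (simp add: sin_ge_zero)
  then show ?thesis
    using chebyshev_cartan(1)[OF assms(1-3) False] by (simp add: zero_le_mult_iff)
qed

text \<open>Two adjacent letters rotate the plane of the roots by \<open>2 * pi / m x y\<close>, so
  \<open>m x y\<close> such pairs act trivially there.\<close>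

lemma rotation_roots:
  assumes xy: "x \<in> S" "y \<in> S" "x \<noteq> y" "m x y \<noteq> 0"
  shows "word_act (alternating y x (2 * m x y)) (unit_vec x) = unit_vec x"
    and "word_act (alternating y x (2 * m x y)) (unit_vec y) = unit_vec y"
proof -
  let ?\<theta> = "pi / m x y" and ?u = "chebyshev (- cartan x y)"
  note sinp = chebyshev_cartan(1)[OF xy] and cheb = chebyshev_cartan(2)[OF xy]
  have "sin (real (2 * m x y) * ?\<theta>) = 0"
    using xy(4) by simp
  then have u0: "?u (2 * m x y) = 0"
    using sinp cheb[of "2 * m x y"] by (metis less_irrefl mult_eq_0_iff)
  have "real (Suc (2 * m x y)) * ?\<theta> = ?\<theta> + 2 * pi"
    unfolding of_nat_Suc distrib_right using xy(4) by simp
  then have "sin (real (Suc (2 * m x y)) * ?\<theta>) = sin ?\<theta>"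
    by (metis sin_periodic)
  then have u1: "?u (Suc (2 * m x y)) = 1"
    using sinp cheb[of "Suc (2 * m x y)"] by (metis less_irrefl mult_cancel_left1)
  \<comment> \<open>The root of \<open>y\<close> is negated by the last letter, which leaves a word
    of odd length \<open>k = 2 * m x y - 1\<close>; the recurrence, solved backwards, gives the
    coefficient -1 at \<open>k\<close>.\<close>
  obtain k where k: "2 * m x y = Suc k" using xy(4) by (cases "2 * m x y") auto
  then have odd: "odd k" by (metis even_Suc even_mult_iff even_numeral)
  have "?u (Suc (Suc k)) = - cartan x y * ?u (Suc k) - ?u k" by simp
  then have u2: "?u k = - 1" using u0 u1 unfolding k by simp
  show "word_act (alternating y x (2 * m x y)) (unit_vec x) = unit_vec x"
    using u0 u1 by (simp add: alternating_act_root xy del: chebyshev.simps)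
  have "word_act (alternating y x (2 * m x y)) (unit_vec y) =
      word_act (alternating x y k) (\<lambda>r. - unit_vec y r)"
    unfolding k by (simp add: refl_map_root xy)
  also have "\<dots> = (\<lambda>r. - word_act (alternating x y k) (unit_vec y) r)"
    by (rule word_act_uminus)
  also have "\<dots> = unit_vec y"
    using u0 u2 odd unfolding k
    by (simp add: alternating_act_root xy cartan_sym[of y x] del: chebyshev.simps)
  finally show "word_act (alternating y x (2 * m x y)) (unit_vec y) = unit_vec y" .
qed

lemma rotation_order:
  assumes "x \<in> S" "y \<in> S"
  shows "word_act (alternating y x (2 * m x y)) v = v"
proof (cases "m x y = 0 \<or> x = y")
  case True
  \<comment> \<open>These are the two cases in which the Gram determinant vanishes; the word is then
    empty or \<open>[x, x]\<close>.\<close>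
  then show ?thesis using assms by (auto simp: m_diag numeral_2_eq_2 refl_map_involution)
next
  case False
  then have xy: "x \<in> S" "y \<in> S" "x \<noteq> y" "m x y \<noteq> 0" using assms by auto
  \<comment> \<open>\<open>v\<close> is the sum of a vector \<open>p\<close> in the plane of the two roots and a vector \<open>v'\<close> fixed by both
    reflections; this is possible because the Gram determinant \<open>d\<close> does not vanish.\<close>
  define q where "q = cartan x y"
  define X Y where "X = coroot x v" and "Y = coroot y v"
  define d where "d = 4 - q\<^sup>2"
  define a b where "a = (2 * X - q * Y) / d" and "b = (2 * Y - q * X) / d"
  have "d = 4 * (sin (pi / m x y))\<^sup>2"
    by (simp add: d_def q_def cartan_def power_mult_distrib sin_squared_eq)
  then have d: "d \<noteq> 0" using chebyshev_cartan(1)[OF xy] by simp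
  have ab: "2 * a + q * b = X" "q * a + 2 * b = Y"
  proof -
    have "(2 * a + q * b) * d = X * d"
      using d by (simp add: a_def b_def distrib_right) (simp add: d_def power2_eq_square algebra_simps)
    then show "2 * a + q * b = X" using d by simp
    have "(q * a + 2 * b) * d = Y * d"
      using d by (simp add: a_def b_def distrib_right) (simp add: d_def power2_eq_square algebra_simps)
    then show "q * a + 2 * b = Y" using d by simp
  qed
  define p where "p = (\<lambda>r. a * unit_vec x r + b * unit_vec y r)"
  define v' where "v' = (\<lambda>r. 1 * v r + (- 1) * p r)"
  have v: "v = (\<lambda>r. 1 * v' r + 1 * p r)" by (simp add: v'_def)
  have "coroot x p = X" "coroot y p = Y"
    using xy ab by (simp_all add: p_def coroot_linear coroot_unit_vec cartan_diag 
       cartan_sym[of y x] q_def algebra_simps)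
  then have "coroot x v' = 0" "coroot y v' = 0"
    unfolding v'_def coroot_linear by (simp_all add: X_def Y_def)
  then have 1: "word_act (alternating y x (2 * m x y)) v' = v'"
    using set_alternating[of y x] by (intro word_act_fix) blast
  have 2: "word_act (alternating y x (2 * m x y)) p = p"
    unfolding p_def word_act_linear rotation_roots[OF xy] ..
  have "word_act (alternating y x (2 * m x y)) v = (\<lambda>r. 1 * v' r + 1 * p r)"
    by (subst v, subst word_act_linear) (simp only: 1 2)
  also have "\<dots> = v" by (rule v[symmetric])
  finally show ?thesis .
qed

section \<open>Relations in \<open>W\<close> and the passage from words to group elements\<close>

lemma eval_gword_positive: "eval_gword W (map (\<lambda>x. (x, True)) xs) = list_mult W xs"
  by (simp add: eval_gword_def comp_def)

lemma eval_gword_eq_one_iff: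
  "u \<in> lists (S \<times> UNIV) \<Longrightarrow> eval_gword W u = \<one> \<longleftrightarrow> gword_eq S (coxeter_relators S m) u []"
  using presentation by (auto simp: has_presentation_def)

lemma map_fst_relator:
  "map fst (concat (replicate k [(x, b), (y, c)])) = concat (replicate k [x, y])"
  by (induction k) auto

lemma list_mult_relator:
  assumes "x \<in> S" "y \<in> S"
  shows "list_mult W (alternating y x (2 * m x y)) = \<one>"
proof -
  let ?r = "concat (replicate (m x y) [(x, True), (y, True)])"
  have "?r \<in> coxeter_relators S m"
    using assms by (auto simp: coxeter_relators_def)
  then have "gword_eq S (coxeter_relators S m) ?r []"
    using gword_eq.relator[of ?r _ S "[]" "[]"] by simp
  moreover have "concat (replicate k [(x, True), (y, True)]) \<in> lists (S \<times> UNIV)" for k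
    using assms by (induction k) auto
  ultimately have "eval_gword W ?r = \<one>" using eval_gword_eq_one_iff by blast
  moreover have "?r = map (\<lambda>x. (x, True)) (concat (replicate (m x y) [x, y]))"
    by (simp add: map_concat)
  ultimately show ?thesis
    unfolding alternating_even by (simp only: eval_gword_positive)
qed

lemma generator_square: "x \<in> S \<Longrightarrow> x \<otimes> x = \<one>"
  using list_mult_relator[of x x] S_carrier by (auto simp: m_diag numeral_2_eq_2)

lemma generator_carrier [simp]: "x \<in> S \<Longrightarrow> x \<in> carrier W"
  using S_carrier by blast

lemma inv_generator: "x \<in> S \<Longrightarrow> inv x = x"
  using generator_square by (simp add: inv_equality)

lemma mult_generator_twice: "x \<in> S \<Longrightarrow> g \<in> carrier W \<Longrightarrow> g \<otimes> x \<otimes> x = g"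
  by (simp add: m_assoc generator_square)

lemma word_closed [simp]: "xs \<in> lists S \<Longrightarrow> list_mult W xs \<in> carrier W"
  using list_mult_closed lists_carrier by blast

lemma word_append:
  "xs \<in> lists S \<Longrightarrow> ys \<in> lists S \<Longrightarrow>
    list_mult W (xs @ ys) = list_mult W xs \<otimes> list_mult W ys"
  by (intro list_mult_append lists_carrier)

lemma rev_lists [simp]: "rev xs \<in> lists A \<longleftrightarrow> xs \<in> lists A"
  by (simp add: in_lists_conv_set)

lemma word_rev: "xs \<in> lists S \<Longrightarrow> list_mult W (rev xs) = inv (list_mult W xs)"
proof (induction xs)
  case (Cons x xs)
  then show ?case
    by (simp add: word_append inv_mult_group inv_generator)
qed simp

lemma alternating_lists: "x \<in> S \<Longrightarrow> y \<in> S \<Longrightarrow> alternating x y k \<in> lists S"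
  using set_alternating[of x y k] by auto

text \<open>The left half of the relator word, of length \<open>2 * m x y\<close>, is the reverse of
  \<open>alternating x y (m x y)\<close> and so represents its inverse.\<close>

lemma braid_relation:
  assumes "x \<in> S" "y \<in> S"
  shows "list_mult W (alternating y x (m x y)) = list_mult W (alternating x y (m x y))"
proof -
  let ?k = "m x y"
  have "alternating y x (?k + ?k) = rev (alternating x y ?k) @ alternating y x ?k"
    by (simp only: alternating_add rev_alternating)
  then have "inv (list_mult W (alternating x y ?k)) \<otimes> list_mult W (alternating y x ?k) = \<one>"
    using list_mult_relator[OF assms] assms
    by (simp add: mult_2 word_append word_rev alternating_lists)
  then show ?thesis
    using assms by (metis inv_equality inv_inv alternating_lists word_closed inv_closed)
qed

lemma gword_eq_act:
  "gword_eq S (coxeter_relators S m) u v \<Longrightarrow> word_act (map fst u) w = word_act (map fst v) w"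
proof (induction arbitrary: w rule: gword_eq.induct)
  case (relator r u v)
  then obtain x y where "x \<in> S" "y \<in> S" "r = concat (replicate (m x y) [(x, True), (y, True)])"
    by (auto simp: coxeter_relators_def)
  then have "map fst r = alternating y x (2 * m x y)"
    by (simp only: map_fst_relator alternating_even)
  with \<open>x \<in> S\<close> \<open>y \<in> S\<close> show ?case by (simp add: rotation_order)
qed (simp_all add: refl_map_involution)

text \<open>By the kernel condition of the presentation, a word representing the identity is
  derivable from the relators. This is what makes the action of \<open>W\<close> well
  defined.\<close>

lemma word_act_one:
  assumes "xs \<in> lists S" "list_mult W xs = \<one>"
  shows "word_act xs v = v"
proof -
  have "map (\<lambda>x. (x, True)) xs \<in> lists (S \<times> UNIV)" using assms(1) by auto
  then have "gword_eq S (coxeter_relators S m) (map (\<lambda>x. (x, True)) xs) []"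
    using assms(2) eval_gword_eq_one_iff by (metis eval_gword_positive)
  from gword_eq_act[OF this] show ?thesis by (simp add: comp_def)
qed

lemma word_act_rev: "xs \<in> lists S \<Longrightarrow> word_act (rev xs) (word_act xs v) = v"
  by (induction xs arbitrary: v) (auto simp: refl_map_involution)

lemma word_act_cong:
  assumes "xs \<in> lists S" "ys \<in> lists S" "list_mult W xs = list_mult W ys"
  shows "word_act xs v = word_act ys v"
proof -
  have rev: "rev ys \<in> lists S" using assms(2) by auto
  have "list_mult W (xs @ rev ys) = \<one>"
    using assms rev by (simp add: word_append word_rev)
  moreover have "xs @ rev ys \<in> lists S" using assms(1) rev by simp
  ultimately have "word_act (xs @ rev ys) (word_act ys v) = word_act ys v"
    using word_act_one by blast
  then show ?thesis using assms(2) by (simp add: word_act_rev)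
qed

lemma ex_word:
  assumes "g \<in> carrier W"
  shows "\<exists>xs\<in>lists S. list_mult W xs = g"
proof -
  have "g \<in> generate W S" using assms generate_S by simp
  then show ?thesis
  proof induction
    case one
    show ?case by (intro bexI[of _ "[]"]) auto
  next
    case (incl h)
    then show ?case by (intro bexI[of _ "[h]"]) auto
  next
    case (inv h)
    then show ?case by (intro bexI[of _ "[h]"]) (auto simp: inv_generator)
  next
    case (eng h1 h2)
    then obtain xs ys where "xs \<in> lists S" "ys \<in> lists S"
      "list_mult W xs = h1" "list_mult W ys = h2" by blast
    then show ?case by (intro bexI[of _ "xs @ ys"]) (auto simp: word_append)
  qed
qed

definition act :: "'a \<Rightarrow> ('a \<Rightarrow> real) \<Rightarrow> 'a \<Rightarrow> real" where
  "act g = word_act (SOME xs. xs \<in> lists S \<and> list_mult W xs = g)"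

lemma act_word: "xs \<in> lists S \<Longrightarrow> act (list_mult W xs) v = word_act xs v"
  unfolding act_def by (rule someI2[of _ xs]) (auto intro: word_act_cong)

lemma act_one [simp]: "act \<one> v = v"
  using act_word[of "[]"] by simp

lemma act_generator: "x \<in> S \<Longrightarrow> act x v = refl_map x v"
  using act_word[of "[x]"] by simp

lemma act_mult:
  assumes "g \<in> carrier W" "h \<in> carrier W"
  shows "act (g \<otimes> h) v = act g (act h v)"
proof -
  obtain xs ys where *: "xs \<in> lists S" "ys \<in> lists S" "list_mult W xs = g" "list_mult W ys = h"
    using assms ex_word by meson
  then have "xs @ ys \<in> lists S" by simp
  then have "act (list_mult W (xs @ ys)) v = word_act xs (word_act ys v)"
    by (simp only: act_word word_act_simps)
  then show ?thesis using * word_append act_word by metis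
qed

lemma act_inv:
  assumes "g \<in> carrier W"
  shows "act (inv g) (act g v) = v" "act g (act (inv g) v) = v"
  using assms act_mult[of "inv g" g v] act_mult[of g "inv g" v] by simp_all

lemma act_linear: "act g (\<lambda>r. a * v r + b * w r) = (\<lambda>r. a * act g v r + b * act g w r)"
  unfolding act_def by (rule word_act_linear)

lemma act_sum: "act g (\<lambda>r. \<Sum>i\<in>I. f i r) = (\<lambda>r. \<Sum>i\<in>I. act g (f i) r)"
  unfolding act_def by (rule word_act_sum)

lemma act_uminus: "act g (\<lambda>r. - v r) = (\<lambda>r. - act g v r)"
  unfolding act_def by (rule word_act_uminus)

lemma act_scale: "act g (\<lambda>r. a * v r) = (\<lambda>r. a * act g v r)"
  using act_linear[of g a v 0 v] by simp

section \<open>Signs of roots\<close>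

definition len :: "'a \<Rightarrow> nat" where
  "len g = (LEAST k. \<exists>xs\<in>lists S. list_mult W xs = g \<and> length xs = k)"

lemma len_le: "xs \<in> lists S \<Longrightarrow> len (list_mult W xs) \<le> length xs"
  unfolding len_def by (rule Least_le) blast

lemma ex_reduced_word:
  assumes "g \<in> carrier W"
  shows "\<exists>xs\<in>lists S. list_mult W xs = g \<and> length xs = len g"
  unfolding len_def by (rule LeastI_ex) (use ex_word[OF assms] in blast)

lemma len_mult_word:
  assumes "g \<in> carrier W" "ys \<in> lists S"
  shows "len (g \<otimes> list_mult W ys) \<le> len g + length ys"
proof -
  obtain xs where xs: "xs \<in> lists S" "list_mult W xs = g" "length xs = len g"
    using ex_reduced_word[OF assms(1)] by blast
  then have "xs @ ys \<in> lists S" using assms(2) by simp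
  from len_le[OF this] show ?thesis
    using xs assms(2) word_append by (metis length_append)
qed

lemma ex_descent:
  assumes "g \<in> carrier W" "g \<noteq> \<one>"
  shows "\<exists>t\<in>S. len (g \<otimes> t) < len g"
proof -
  obtain xs where xs: "xs \<in> lists S" "list_mult W xs = g" "length xs = len g"
    using ex_reduced_word[OF assms(1)] by blast
  then obtain ys t where ys: "xs = ys @ [t]"
    using assms(2) by (cases xs rule: rev_cases) auto
  then have *: "ys \<in> lists S" "t \<in> S" using xs(1) by auto
  then have "g = list_mult W ys \<otimes> t"
    using xs(2) ys by (simp add: list_mult_append lists_carrier)
  then have "g \<otimes> t = list_mult W ys"
    using * mult_generator_twice by (simp)
  then show ?thesis using len_le[OF *(1)] *(2) xs(3) ys by (intro bexI[of _ t]) auto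
qed

text \<open>Together with \<open>act_root_nonpos\<close> this reads the sign of a root off the right
  descents of \<open>g\<close>; the sign dichotomy and faithfulness both rest on it.\<close>

lemma act_root_nonneg:
  assumes "g \<in> carrier W" "s \<in> S" "\<not> len (g \<otimes> s) < len g"
  shows "act g (unit_vec s) r \<ge> 0"
  using assms
proof (induction "len g" arbitrary: g s r rule: less_induct)
  case less
  note g = less.prems(1) and s = less.prems(2)
  show ?case
  proof (cases "g = \<one>")
    case True
    then show ?thesis by (simp add: unit_vec_def)
  next
    case False
    then obtain t where t: "t \<in> S" "len (g \<otimes> t) < len g" using ex_descent g by blast
    then have "s \<noteq> t" using less.prems(3) by auto
    note alt = alternating_lists[OF t(1) s]
    \<comment> \<open>Split off from \<open>g\<close> the longest alternating right factor in \<open>s, t\<close> ending with \<open>t\<close>. The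
      remaining \<open>v\<close> is shorter and has neither \<open>s\<close> nor \<open>t\<close> as a descent, so it sends both roots
      to nonnegative vectors; the factor sends the root of \<open>s\<close> to a nonnegative combination.\<close>
    define P where "P k \<longleftrightarrow> (\<exists>v\<in>carrier W. g = v \<otimes> list_mult W (alternating t s k) \<and>
        len v + k \<le> len g)" for k
    define k where "k = (GREATEST k. P k)"
    have P1: "P 1"
      unfolding P_def using t g
      by (intro bexI[of _ "g \<otimes> t"]) (auto simp: mult_generator_twice)
    have bound: "k \<le> len g" if "P k" for k using that by (auto simp: P_def)
    have "P k" unfolding k_def using P1 bound by (rule GreatestI_nat)
    then obtain v where v: "v \<in> carrier W" "g = v \<otimes> list_mult W (alternating t s k)"
      "len v + k \<le> len g" by (auto simp: P_def)
    have "1 \<le> k" unfolding k_def using P1 bound by (rule Greatest_le_nat)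
    have "\<not> P (Suc k)"
      using Greatest_le_nat[of P "Suc k" "len g"] bound by (auto simp: k_def)
    \<comment> \<open>\<open>x\<close> is the letter that would prolong the alternating factor,
      \<open>y\<close> is its present first letter. A descent of \<open>v\<close> at
      \<open>x\<close> contradicts the maximality of \<open>k\<close>; a descent at \<open>y\<close>
      would make \<open>g\<close> shorter than \<open>len g\<close>.\<close>
    define x y where "x = (if even k then t else s)" and "y = (if even k then s else t)"
    have xy: "x \<in> S" "y \<in> S" using s t by (auto simp: x_def y_def)
    have x: "\<not> len (v \<otimes> x) < len v"
    proof
      assume "len (v \<otimes> x) < len v"
      moreover have "g = (v \<otimes> x) \<otimes> list_mult W (alternating t s (Suc k))"
      proof -
        have "(v \<otimes> x) \<otimes> list_mult W (alternating t s (Suc k)) =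
            (v \<otimes> x) \<otimes> (x \<otimes> list_mult W (alternating t s k))"
          by (simp only: alternating_Cons list_mult_Cons x_def)
        also have "\<dots> = v \<otimes> x \<otimes> x \<otimes> list_mult W (alternating t s k)"
          using v(1) xy alt by (simp add: m_assoc)
        finally show ?thesis using v xy by (simp add: mult_generator_twice)
      qed
      ultimately have "P (Suc k)"
        unfolding P_def using v(1,3) xy by (intro bexI[of _ "v \<otimes> x"]) auto
      then show False using \<open>\<not> P (Suc k)\<close> by blast
    qed
    have y: "\<not> len (v \<otimes> y) < len v"
    proof
      assume *: "len (v \<otimes> y) < len v"
      obtain j where j: "k = Suc j" using \<open>1 \<le> k\<close> by (cases k) auto
      have "list_mult W (alternating t s k) = y \<otimes> list_mult W (alternating t s j)"
        unfolding j alternating_Cons list_mult_Cons y_def by simp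
      then have "g = v \<otimes> y \<otimes> list_mult W (alternating t s j)"
        using v xy alt by (simp add: m_assoc)
      then have "len g \<le> len (v \<otimes> y) + j"
        using len_mult_word[of "v \<otimes> y", OF _ alt] v(1) xy by simp
      then show False using * j v(3) by linarith
    qed
    have "len v < len g" using v(3) \<open>1 \<le> k\<close> by linarith
    then have "act v (unit_vec x) r \<ge> 0" "act v (unit_vec y) r \<ge> 0"
      using less.hyps v(1) xy x y by blast+
    \<comment> \<open>If the factor had \<open>m s t\<close> or more letters, the braid relation
      would rewrite it so as to end in \<open>s\<close>, and \<open>s\<close> would be a descent of
      \<open>g\<close>. The bound keeps both Chebyshev coefficients nonnegative.\<close>
    have k: "m s t = 0 \<or> Suc k \<le> m s t"
    proof (rule ccontr)
      assume neg: "\<not> ?thesis"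
      then obtain j where j: "m s t = Suc j" by (cases "m s t") auto
      define X where "X = (if even (m s t) then alternating t s (k - m s t)
        else alternating s t (k - m s t))"
      have X: "X \<in> lists S" "length X = k - m s t"
        using s t alternating_lists by (auto simp: X_def)
      have "alternating t s k = X @ alternating t s (m s t)"
        using alternating_add[of t s "k - m s t" "m s t"] neg by (simp add: X_def)
      then have "g = v \<otimes> (list_mult W X \<otimes> list_mult W (alternating t s (m s t)))"
        using v X alt by (simp add: word_append)
      also have "list_mult W (alternating t s (m s t)) = list_mult W (alternating t s j) \<otimes> s"
        unfolding braid_relation[OF s t(1)] unfolding j
        using s alt by (simp add: list_mult_append lists_carrier)
      finally have "g = v \<otimes> list_mult W (X @ alternating t s j) \<otimes> s"
        using v(1) X alt s by (simp add: word_append m_assoc)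
      moreover have Y: "X @ alternating t s j \<in> lists S" using X alt by simp
      ultimately have "g \<otimes> s = v \<otimes> list_mult W (X @ alternating t s j)"
        using v(1) s mult_generator_twice by (simp)
      then have "len (g \<otimes> s) \<le> len v + length (X @ alternating t s j)"
        using len_mult_word[OF v(1) Y] by simp
      then have "len (g \<otimes> s) < len g" using X(2) j neg v(3) by simp
      then show False using less.prems(3) by blast
    qed
    have "act g (unit_vec s) = act v (word_act (alternating t s k) (unit_vec s))"
      using v(1,2) alt act_mult act_word by (simp)
    also have "\<dots> = (\<lambda>r. chebyshev (- cartan s t) (Suc k) * act v (unit_vec y) r +
             chebyshev (- cartan s t) k * act v (unit_vec x) r)"
      unfolding alternating_act_root[OF s t(1)] act_linear x_def y_def ..
    finally have "act g (unit_vec s) r = chebyshev (- cartan s t) (Suc k) * act v (unit_vec y) r +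
             chebyshev (- cartan s t) k * act v (unit_vec x) r" by simp
    moreover have "chebyshev (- cartan s t) (Suc k) \<ge> 0" "chebyshev (- cartan s t) k \<ge> 0"
      using k by (auto intro!: chebyshev_cartan_nonneg[OF s t(1) \<open>s \<noteq> t\<close>] simp del: chebyshev.simps)
    ultimately show ?thesis
      using \<open>act v (unit_vec x) r \<ge> 0\<close> \<open>act v (unit_vec y) r \<ge> 0\<close> by simp
  qed
qed

lemma act_root_nonpos:
  assumes "g \<in> carrier W" "s \<in> S" "len (g \<otimes> s) < len g"
  shows "act g (unit_vec s) r \<le> 0"
proof -
  have "act (g \<otimes> s) (unit_vec s) r \<ge> 0"
    using assms by (intro act_root_nonneg) (auto simp: mult_generator_twice)
  moreover have "act (g \<otimes> s) (unit_vec s) = (\<lambda>r. - act g (unit_vec s) r)"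
    using assms by (simp add: act_mult act_generator refl_map_root act_uminus)
  ultimately show ?thesis by simp
qed

text \<open>A nontrivial element has a descent \<open>t\<close> and makes the root of
  \<open>t\<close> nonpositive, so it moves that root.\<close>

lemma act_faithful:
  assumes "g \<in> carrier W" "\<And>v. act g v = v"
  shows "g = \<one>"
proof (rule ccontr)
  assume "g \<noteq> \<one>"
  then obtain t where "t \<in> S" "len (g \<otimes> t) < len g" using ex_descent assms(1) by blast
  then have "act g (unit_vec t) t \<le> 0" using act_root_nonpos assms(1) by blast
  then show False using assms(2) by (simp add: unit_vec_def)
qed

section \<open>The invariant form with Gram matrix \<open>cartan\<close>, and reflections determined
  by their roots\<close>

definition form :: "('a \<Rightarrow> real) \<Rightarrow> ('a \<Rightarrow> real) \<Rightarrow> real" where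
  "form v w = (\<Sum>r\<in>S. v r * coroot r w)"

lemma form_scale: "form (\<lambda>r. a * v r) w = a * form v w"
  by (simp add: form_def sum_distrib_left mult.assoc)

lemma form_unit_vec: "x \<in> S \<Longrightarrow> form (unit_vec x) w = coroot x w"
  using finite_S by (simp add: form_def unit_vec_def if_distrib[of "\<lambda>a. a * _"] cong: if_cong)

lemma form_refl_map:
  assumes "x \<in> S"
  shows "form (refl_map x v) (refl_map x w) = form v w"
proof -
  have col: "(\<Sum>r\<in>S. v r * cartan r x) = coroot x v"
    unfolding coroot_def using assms by (intro sum.cong) (auto simp: cartan_sym)
  have unit: "(\<Sum>r\<in>S. unit_vec x r * f r) = f x" for f
    using finite_S assms by (simp add: unit_vec_def if_distrib[of "\<lambda>a. a * _"] cong: if_cong)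
  have "form (refl_map x v) (refl_map x w) =
      (\<Sum>r\<in>S. v r * coroot r w - coroot x w * (v r * cartan r x)
        - coroot x v * (unit_vec x r * (coroot r w - coroot x w * cartan r x)))"
    unfolding form_def using assms
    by (intro sum.cong) (auto simp: coroot_refl_map refl_map_def[of x v] algebra_simps)
  also have "\<dots> = form v w"
    by (simp add: sum_subtractf sum_distrib_left[symmetric] col unit form_def)
      (simp add: cartan_diag assms algebra_simps)
  finally show ?thesis .
qed

lemma form_act:
  assumes "g \<in> carrier W"
  shows "form (act g v) (act g w) = form v w"
proof -
  have "form (word_act xs v) (word_act xs w) = form v w" if "xs \<in> lists S" for xs
    using that by (induction xs) (auto simp: form_refl_map)
  then show ?thesis using ex_word[OF assms] act_word by metis
qed

text \<open>Invariance of the form shows that \<open>u \<otimes> s \<otimes> inv u\<close> acts as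
  the reflection in \<open>act u (unit_vec s)\<close>. Equal norms of simple roots give
  \<open>a * a = 1\<close>, so this is the reflection in the root of \<open>x\<close>, and
  faithfulness carries the equality back to \<open>W\<close>.\<close>

lemma reflection_eq_generator:
  assumes "u \<in> carrier W" "s \<in> S" "x \<in> S"
    and root: "act u (unit_vec s) = (\<lambda>r. a * unit_vec x r)"
  shows "u \<otimes> s \<otimes> inv u = x"
proof -
  have "coroot s (unit_vec s) = form (act u (unit_vec s)) (act u (unit_vec s))"
    using assms(1,2) form_act form_unit_vec by simp
  also have "\<dots> = a * coroot x (\<lambda>r. a * unit_vec x r)"
    using assms(3) by (simp add: root form_scale form_unit_vec)
  also have "\<dots> = a * a * coroot x (unit_vec x)"
    using coroot_linear[of x a "unit_vec x" 0] by simp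
  finally have "a * a = 1"
    using assms(2,3) by (simp add: coroot_unit_vec cartan_diag)
  have conj: "act (u \<otimes> s \<otimes> inv u) v = refl_map x v" for v
  proof -
    have "coroot s (act (inv u) v) = form (act u (unit_vec s)) (act u (act (inv u) v))"
      using assms(1,2) form_act form_unit_vec by simp
    also have "\<dots> = a * coroot x v"
      using assms(1,3) by (simp add: root form_scale form_unit_vec act_inv)
    finally have "act s (act (inv u) v) =
        (\<lambda>r. 1 * act (inv u) v r + (- a * coroot x v) * unit_vec s r)"
      using assms(2) by (simp add: act_generator refl_map_def)
    then have "act u (act s (act (inv u) v)) = 
        (\<lambda>r. 1 * v r + (- a * coroot x v) * (a * unit_vec x r))"
      using assms(1) by (simp only: act_linear act_inv root)
    also have "\<dots> = refl_map x v"
      using \<open>a * a = 1\<close> by (simp add: refl_map_def fun_eq_iff)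
    finally show ?thesis using assms(1,2) by (simp add: act_mult)
  qed
  have "u \<otimes> s \<otimes> inv u \<otimes> x = \<one>"
    using assms by (intro act_faithful) 
      (simp_all add: act_mult[of _ x] conj act_generator refl_map_involution)
  then show ?thesis
    using assms inv_generator by (metis generator_carrier inv_closed inv_equality inv_inv m_closed)
qed

section \<open>Fixed vectors, averages and sign changes along a word\<close>

lemma act_root_sign:
  assumes "g \<in> carrier W" "s \<in> S"
  shows "(\<forall>r. act g (unit_vec s) r \<ge> 0) \<or> (\<forall>r. act g (unit_vec s) r \<le> 0)"
  using act_root_nonneg[OF assms] act_root_nonpos[OF assms] by blast

lemma word_act_outside: "r \<notin> set xs \<Longrightarrow> word_act xs v r = v r"
  by (induction xs) (auto simp: refl_map_def unit_vec_def)

text \<open>Linear independence of the simple roots at work: the first letter \<open>y\<close> is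
  the only one that touches coordinate \<open>y\<close>, so its contribution to a fixed vector must
  be zero. The tail then fixes \<open>v\<close> too.\<close>

lemma word_act_eq_self_imp:
  assumes "distinct xs" "xs \<in> lists S" "word_act xs v = v" "x \<in> set xs"
  shows "coroot x v = 0"
  using assms
proof (induction xs)
  case (Cons y ys)
  then have y: "y \<in> S" "y \<notin> set ys" by auto
  have *: "word_act ys v = refl_map y v"
    using Cons.prems(3) refl_map_involution[OF y(1), of "word_act ys v"] by simp
  have "coroot y v = 0"
    using word_act_outside[OF y(2), of v] * by (simp add: refl_map_def unit_vec_def)
  moreover from this have "word_act ys v = v" using * by (simp add: refl_map_fix)
  ultimately show ?case using Cons by auto
qed simp

lemma sum_mult_right:
  assumes "a \<in> carrier W"
  shows "(\<Sum>h\<in>carrier W. f (h \<otimes> a)) = (\<Sum>h\<in>carrier W. f h)"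
  using assms
  by (intro sum.reindex_bij_witness[of _ "\<lambda>h. h \<otimes> inv a" "\<lambda>h. h \<otimes> a"]) (auto simp: m_assoc)

lemma sum_act_root:
  assumes "a \<in> carrier W" "s \<in> S"
  shows "(\<Sum>h\<in>carrier W. act (h \<otimes> a) (unit_vec s) r) = 0"
proof -
  let ?f = "\<lambda>h. act h (unit_vec s) r"
  have "(\<Sum>h\<in>carrier W. ?f h) = (\<Sum>h\<in>carrier W. ?f (h \<otimes> s))"
    using assms(2) by (intro sum_mult_right[symmetric]) simp
  also have "\<dots> = (\<Sum>h\<in>carrier W. - ?f h)"
    using assms(2)
    by (intro sum.cong) (simp_all add: act_mult act_generator refl_map_root act_uminus)
  finally have "(\<Sum>h\<in>carrier W. ?f h) = 0" by (simp add: sum_negf)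
  then show ?thesis using sum_mult_right[OF assms(1), of ?f] by simp
qed

text \<open>Letters act from right to left, so \<open>zs\<close> has acted just before
  \<open>x\<close>. If \<open>x\<close> takes a nonnegative root to one that is not, the image is
  nonpositive by the sign dichotomy; as only coordinate \<open>x\<close> has changed, all others are
  zero.\<close>

lemma crossing_letter:
  assumes "u \<in> carrier W" "s \<in> S" "ws \<in> lists S"
    and "\<forall>r. act u (unit_vec s) r \<ge> 0"
    and "\<not> (\<forall>r. word_act ws (act u (unit_vec s)) r \<ge> 0)"
  shows "\<exists>ys x zs a. ws = ys @ x # zs \<and> word_act zs (act u (unit_vec s)) = (\<lambda>r. a * unit_vec x r)"
  using assms(3,5)
proof (induction ws rule: list.induct)
  case Nil
  then show ?case using assms(4) by simp
next
  case (Cons x ws)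
  let ?d = "word_act ws (act u (unit_vec s))"
  show ?case
  proof (cases "\<forall>r. ?d r \<ge> 0")
    case True
    have "x # ws \<in> lists S" using Cons.prems(1) .
    then have "word_act (x # ws) (act u (unit_vec s)) =
        act (list_mult W (x # ws) \<otimes> u) (unit_vec s)"
      using assms(1) by (simp only: act_mult act_word word_closed)
    then have "\<forall>r. word_act (x # ws) (act u (unit_vec s)) r \<le> 0"
      using act_root_sign[of "list_mult W (x # ws) \<otimes> u" s] Cons.prems assms(1,2)
        word_closed[OF \<open>x # ws \<in> lists S\<close>] by (metis m_closed)
    then have "?d r - coroot x ?d * unit_vec x r \<le> 0" for r
      by (simp add: refl_map_def)
    then have "?d r \<le> 0" if "r \<noteq> x" for r
      using that by (metis diff_zero mult_zero_right unit_vec_def)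
    then have "?d r = 0" if "r \<noteq> x" for r
      using that True by (simp add: order_antisym)
    then have "?d = (\<lambda>r. ?d x * unit_vec x r)" by (auto simp: unit_vec_def)
    then show ?thesis by blast
  next
    case False
    then obtain ys y zs a where "ws = ys @ y # zs"
      "word_act zs (act u (unit_vec s)) = (\<lambda>r. a * unit_vec y r)"
      using Cons by auto
    then have "x # ws = (x # ys) @ y # zs" by simp
    then show ?thesis
      using \<open>word_act zs (act u (unit_vec s)) = (\<lambda>r. a * unit_vec y r)\<close> by blast
  qed
qed

end

section \<open>Orbits of the Coxeter element on roots\<close>

locale finite_coxeter = coxeter +
  fixes xs :: "'a list" and c :: 'a
  assumes finite_W: "finite (carrier W)"
    and xs: "distinct xs" "set xs = S"
    and c: "c = list_mult W xs"
begin

lemma xs_lists: "xs \<in> lists S"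
  using xs by auto

lemma c_closed [simp]: "c \<in> carrier W"
  using xs_lists c by simp

lemma order_pos: "0 < order W"
  using finite_W by (simp add: order_gt_0_iff_finite)

lemma c_pow_order: "c [^] order W = \<one>"
  by (rule pow_order_eq_1) simp

lemma act_c_fixed:
  assumes "act c v = v" "h \<in> carrier W"
  shows "act h v = v"
proof -
  have "coroot x v = 0" if "x \<in> S" for x
    using assms(1) that word_act_eq_self_imp[OF xs(1) xs_lists] xs(2) act_word[OF xs_lists]
    by (simp add: c)
  moreover obtain ys where "ys \<in> lists S" "list_mult W ys = h" using ex_word assms(2) by blast
  ultimately show ?thesis using act_word[of ys v] word_act_fix[of ys v] by auto
qed

text \<open>The exponents run over \<open>order W\<close> values, a whole number of periods because
  \<open>c [^] order W = \<one>\<close>; hence the sum is fixed by \<open>c\<close>.\<close>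

lemma orbit_sum:
  assumes g: "g \<in> carrier W" and s: "s \<in> S"
  shows "(\<Sum>k<order W. act (c [^] k \<otimes> g) (unit_vec s) r) = 0"
proof -
  define f where "f k = act (c [^] k \<otimes> g) (unit_vec s)" for k :: nat
  define v where "v = (\<lambda>r. \<Sum>k<order W. f k r)"
  have "act c (f k) = f (Suc k)" for k
    using g nat_pow_Suc2[of c k] by (simp add: f_def act_mult[symmetric] m_assoc del: nat_pow_Suc)
  then have "act c v = (\<lambda>r. \<Sum>k<order W. f (Suc k) r)"
    unfolding v_def act_sum by simp
  also have "\<dots> = v"
  proof
    fix r
    have "f (order W) r = f 0 r"
      using g by (simp add: f_def c_pow_order)
    moreover have "(\<Sum>k<order W. f k r) + f (order W) r = f 0 r + (\<Sum>k<order W. f (Suc k) r)"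
      using sum.lessThan_Suc_shift[of "\<lambda>k. f k r" "order W"] by simp
    ultimately show "(\<Sum>k<order W. f (Suc k) r) = v r" by (simp add: v_def)
  qed
  finally have fixed: "act h v = v" if "h \<in> carrier W" for h
    using act_c_fixed that by blast
  have "real (order W) * v r = (\<Sum>h\<in>carrier W. act h v r)"
    by (simp add: fixed order_def)
  also have "\<dots> = (\<Sum>h\<in>carrier W. \<Sum>k<order W. act h (f k) r)"
    unfolding v_def act_sum ..
  also have "\<dots> = (\<Sum>k<order W. \<Sum>h\<in>carrier W. act h (f k) r)"
    by (rule sum.swap)
  also have "\<dots> = (\<Sum>k<order W. \<Sum>h\<in>carrier W. act (h \<otimes> (c [^] k \<otimes> g)) (unit_vec s) r)"
    using g by (intro sum.cong) (simp_all add: f_def act_mult)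
  also have "\<dots> = 0"
    using g s by (simp add: sum_act_root)
  finally show ?thesis using order_pos by (simp add: v_def f_def)
qed

text \<open>Nonnegative terms with sum zero all vanish, but no root is the zero vector, since
  \<open>act g\<close> is invertible.\<close>

lemma orbit_not_nonneg:
  assumes "g \<in> carrier W" "s \<in> S"
  shows "\<exists>k. \<not> (\<forall>r. act (c [^] (k::nat) \<otimes> g) (unit_vec s) r \<ge> 0)"
proof (rule ccontr)
  assume "\<not> ?thesis"
  then have nonneg: "act (c [^] k \<otimes> g) (unit_vec s) r \<ge> 0" for k :: nat and r by blast
  have "act g (unit_vec s) r = 0" for r
  proof -
    have "\<forall>k\<in>{..<order W}. act (c [^] k \<otimes> g) (unit_vec s) r = 0"
      using orbit_sum[OF assms, of r] nonneg
      by (subst sum_nonneg_eq_0_iff[symmetric]) auto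
    then have "act (c [^] (0::nat) \<otimes> g) (unit_vec s) r = 0" using order_pos by blast
    then show ?thesis using assms by simp
  qed
  then have "act g (unit_vec s) = (\<lambda>r. 0 * unit_vec s r)" by auto
  then have "unit_vec s = act (inv g) (\<lambda>r. 0 * unit_vec s r)"
    using assms act_inv by metis
  then have "unit_vec s = (\<lambda>r. 0)" unfolding act_scale by simp
  then show False by (metis unit_vec_def zero_neq_one)
qed

text \<open>Multiplying \<open>g\<close> by \<open>s\<close> on the right negates the root, so this
  is \<open>orbit_not_nonneg\<close> for the negative root, combined with the sign
  dichotomy.\<close>

lemma orbit_nonneg:
  assumes "g \<in> carrier W" "s \<in> S"
  shows "\<exists>k. \<forall>r. act (c [^] (k::nat) \<otimes> g) (unit_vec s) r \<ge> 0"
proof -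
  obtain k :: nat and r where "act (c [^] k \<otimes> (g \<otimes> s)) (unit_vec s) r < 0"
    using orbit_not_nonneg[of "g \<otimes> s" s] assms by (auto simp: not_le)
  moreover have "act (c [^] k \<otimes> (g \<otimes> s)) (unit_vec s) = (\<lambda>r. - act (c [^] k \<otimes> g) (unit_vec s) r)"
    using assms by (simp add: act_mult act_generator refl_map_root act_uminus)
  ultimately have "act (c [^] k \<otimes> g) (unit_vec s) r > 0" by simp
  then show ?thesis
    using act_root_sign[of "c [^] k \<otimes> g" s] assms by (meson c_closed m_closed nat_pow_closed not_le)
qed

text \<open>Otherwise a nonnegative member would keep every later one nonnegative; restarted at that
  member, the orbit contradicts \<open>orbit_not_nonneg\<close>.\<close>

lemma orbit_sign_change:
  assumes g: "g \<in> carrier W" and s: "s \<in> S"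
  shows "\<exists>k. (\<forall>r. act (c [^] (k::nat) \<otimes> g) (unit_vec s) r \<ge> 0) \<and>
             \<not> (\<forall>r. act (c [^] Suc k \<otimes> g) (unit_vec s) r \<ge> 0)"
proof (rule ccontr)
  assume neg: "\<not> ?thesis"
  define P where "P k \<longleftrightarrow> (\<forall>r. act (c [^] k \<otimes> g) (unit_vec s) r \<ge> 0)" for k :: nat
  have step: "P (Suc k)" if "P k" for k
    using neg that unfolding P_def by blast
  obtain k where "P k" using orbit_nonneg[OF assms] P_def by blast
  then have "P (j + k)" for j by (induction j) (simp_all add: step)
  then have "\<forall>r. act (c [^] j \<otimes> (c [^] k \<otimes> g)) (unit_vec s) r \<ge> 0" for j :: nat
    using g by (simp add: P_def nat_pow_mult[symmetric] m_assoc)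
  then show False using orbit_not_nonneg[of "c [^] k \<otimes> g" s] g s by simp
qed

lemma reflection_c_conjugate:
  assumes w: "w \<in> carrier W" and s: "s \<in> S"
  shows "\<exists>l ys x zs. xs = ys @ x # zs \<and>
    w \<otimes> s \<otimes> inv w = c [^] (l::nat) \<otimes> list_mult W (ys @ x # rev ys) \<otimes> inv (c [^] l)"
proof -
  obtain k :: nat where k: "\<forall>r. act (c [^] k \<otimes> w) (unit_vec s) r \<ge> 0"
    "\<not> (\<forall>r. act (c [^] Suc k \<otimes> w) (unit_vec s) r \<ge> 0)"
    using orbit_sign_change[OF assms] by blast
  define b where "b = c [^] k"
  have b: "b \<in> carrier W" by (simp add: b_def)
  have Suc: "c [^] Suc k = c \<otimes> b" unfolding b_def by (rule nat_pow_Suc2) simp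
  have "act (c [^] Suc k \<otimes> w) (unit_vec s) = word_act xs (act (b \<otimes> w) (unit_vec s))"
    unfolding Suc using b w act_word[OF xs_lists] by (simp add: m_assoc act_mult c[symmetric])
  then obtain ys x zs a where split: "xs = ys @ x # zs"
    and root: "word_act zs (act (b \<otimes> w) (unit_vec s)) = (\<lambda>r. a * unit_vec x r)"
    using crossing_letter[of "b \<otimes> w" s xs] k b w s xs_lists by (auto simp: b_def)
  have ys: "ys \<in> lists S" and x: "x \<in> S" and zs: "zs \<in> lists S"
    using xs_lists split by auto
  define y z where "y = list_mult W ys" and "z = list_mult W zs"
  have y: "y \<in> carrier W" and z: "z \<in> carrier W" using ys zs by (simp_all add: y_def z_def)
  \<comment> \<open>\<open>d\<close> is \<open>c [^] k\<close> followed by the letters of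
    \<open>c\<close> that act before \<open>x\<close>; it carries the root of
    \<open>w \<otimes> s \<otimes> inv w\<close> to a multiple of the simple root of
    \<open>x\<close>.\<close>
  define d where "d = z \<otimes> b"
  have d: "d \<in> carrier W" using z b by (simp add: d_def)
  have "act (d \<otimes> w) (unit_vec s) = (\<lambda>r. a * unit_vec x r)"
    using root zs b w z by (simp add: d_def z_def act_word act_mult m_assoc)
  then have "(d \<otimes> w) \<otimes> s \<otimes> inv (d \<otimes> w) = x"
    using reflection_eq_generator d w s x by simp
  then have "d \<otimes> (w \<otimes> s \<otimes> inv w) \<otimes> inv d = x"
    using d w s by (simp add: inv_mult_group m_assoc)
  then have "inv d \<otimes> x \<otimes> d = inv d \<otimes> (d \<otimes> (w \<otimes> s \<otimes> inv w) \<otimes> inv d) \<otimes> d" by simp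
  also have "\<dots> = w \<otimes> s \<otimes> inv w"
    using d w s by (simp add: m_assoc inv_solve_left')
  finally have refl: "w \<otimes> s \<otimes> inv w = inv d \<otimes> x \<otimes> d" ..
  \<comment> \<open>Since \<open>c = y \<otimes> x \<otimes> z\<close>, the power \<open>p\<close>
    equals \<open>y \<otimes> x \<otimes> d\<close>; solving for \<open>d\<close> turns conjugation
    of \<open>x\<close> by \<open>d\<close> into conjugation of the palindrome by
    \<open>p\<close>.\<close>
  define p where "p = c [^] Suc k"
  have p: "p = y \<otimes> (x \<otimes> d)"
    unfolding p_def Suc using ys zs x y z b
    by (simp add: c split y_def z_def d_def word_append m_assoc)
  have R: "list_mult W (ys @ x # rev ys) = y \<otimes> (x \<otimes> inv y)"
    using ys x by (simp add: word_append word_rev y_def)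
  have cancel: "inv y \<otimes> (y \<otimes> q) = q" "x \<otimes> (x \<otimes> q) = q" if "q \<in> carrier W" for q
    using that x y by (simp_all add: m_assoc[symmetric] generator_square)
  have conj: "inv d \<otimes> x \<otimes> d = inv p \<otimes> list_mult W (ys @ x # rev ys) \<otimes> p"
    unfolding p R using x y d by (simp add: inv_mult_group m_assoc cancel inv_generator)
  \<comment> \<open>Exponents must be natural numbers, so the inverse of \<open>c [^] Suc k\<close>
    is written as \<open>c [^] l\<close>, using \<open>c [^] order W = \<one>\<close>.\<close>
  define l where "l = (order W - 1) * Suc k"
  have "l + Suc k = order W * Suc k" using order_pos by (cases "order W") (simp_all add: l_def)
  then have "c [^] l \<otimes> p = \<one>"
    unfolding p_def by (simp only: nat_pow_mult c_closed nat_pow_pow[symmetric] c_pow_order nat_pow_one)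
  then have "inv p = c [^] l" unfolding p_def by (intro inv_equality) simp_all
  moreover from this have "p = inv (c [^] l)" by (metis c_closed inv_inv nat_pow_closed p_def)
  ultimately show ?thesis using refl conj split by metis
qed

end

theorem proposition3p4:
  fixes W :: "('a, 'b) monoid_scheme" (structure)
    and S :: "'a set" and s :: "nat \<Rightarrow> 'a" and n :: nat and c :: 'a
  assumes "coxeter_system W S"
    and "finite (carrier W)"
    and "bij_betw s {1..n} S"
    and "c = list_mult W (map s [1..<Suc n])"
  shows "reflections W S =
    {c [^] k \<otimes> list_mult W (map s ([1..<Suc i] @ rev [1..<i])) \<otimes> inv (c [^] k) | (k::nat) (i::nat).
       1 \<le> i \<and> i \<le> n}"
proof -
  obtain m where m: "coxeter_matrix S m" "has_presentation W S (coxeter_relators S m)"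
    using assms(1) by (auto simp: coxeter_system_def)
  interpret group W using m(2) by (simp add: has_presentation_def)
  interpret finite_coxeter W S m "map s [1..<Suc n]" c
  proof unfold_locales
    show "finite S" using assms(3) bij_betw_finite by blast
    have range: "set [1..<Suc n] = {1..n}" by auto
    show "distinct (map s [1..<Suc n])"
      unfolding distinct_map range using assms(3) by (auto simp: bij_betw_def)
    show "set (map s [1..<Suc n]) = S"
      unfolding set_map range using assms(3) by (auto simp: bij_betw_def)
  qed (use m assms in auto)
  have word: "map s ([1..<Suc i] @ rev [1..<i]) = map s [1..<i] @ s i # rev (map s [1..<i])"
    if "1 \<le> i" for i
    using that by (simp add: rev_map)
  have s: "s i \<in> S" if "1 \<le> i" "i \<le> n" for i
    using that assms(3) by (auto simp: bij_betw_def)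
  show ?thesis
  proof (intro subset_antisym subsetI)
    fix t assume "t \<in> reflections W S"
    then obtain w x where w: "w \<in> carrier W" "x \<in> S" "t = w \<otimes> x \<otimes> inv w"
      by (auto simp: reflections_def)
    then obtain l ys y zs where split: "map s [1..<Suc n] = ys @ y # zs"
      and t: "t = c [^] (l::nat) \<otimes> list_mult W (ys @ y # rev ys) \<otimes> inv (c [^] l)"
      using reflection_c_conjugate by blast
    \<comment> \<open>List positions start at 0 but generators are numbered from 1, so the letter
      after \<open>ys\<close> is \<open>s (Suc (length ys))\<close>.\<close>
    define i where "i = Suc (length ys)"
    have "length (map s [1..<Suc n]) = length (ys @ y # zs)" by (simp only: split)
    then have i: "1 \<le> i" "i \<le> n" by (auto simp: i_def simp del: upt_Suc)
    have "ys = take (length ys) (map s [1..<Suc n])" by (simp only: split) simp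
    also have "\<dots> = map s [1..<i]" using i by (simp add: i_def take_map take_upt del: upt_Suc)
    finally have ys: "ys = map s [1..<i]" .
    have "y = map s [1..<Suc n] ! length ys" by (simp only: split nth_append_length)
    also have "\<dots> = s i" using i by (simp add: i_def del: upt_Suc)
    finally have "ys @ y # rev ys = map s ([1..<Suc i] @ rev [1..<i])"
      using word[OF i(1)] ys by simp
    then show "t \<in> {c [^] k \<otimes> list_mult W (map s ([1..<Suc i] @ rev [1..<i])) \<otimes> inv (c [^] k) |
        (k::nat) (i::nat). 1 \<le> i \<and> i \<le> n}"
      using t i by auto
  next
    fix t assume "t \<in> {c [^] k \<otimes> list_mult W (map s ([1..<Suc i] @ rev [1..<i])) \<otimes> inv (c [^] k) |
        (k::nat) (i::nat). 1 \<le> i \<and> i \<le> n}"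
    then obtain k i :: nat where i: "1 \<le> i" "i \<le> n" and
      t: "t = c [^] k \<otimes> list_mult W (map s ([1..<Suc i] @ rev [1..<i])) \<otimes> inv (c [^] k)" by auto
    define y where "y = list_mult W (map s [1..<i])"
    have ys: "map s [1..<i] \<in> lists S" using i s by auto
    then have y: "y \<in> carrier W" by (simp add: y_def)
    have "list_mult W (map s ([1..<Suc i] @ rev [1..<i])) = y \<otimes> (s i \<otimes> inv y)"
      unfolding word[OF i(1)] y_def using ys s[OF i]
      by (simp only: word_append word_rev list_mult_Cons rev_lists Cons_in_lists_iff)
    then have "t = (c [^] k \<otimes> y) \<otimes> s i \<otimes> inv (c [^] k \<otimes> y)"
      unfolding t using y s[OF i] by (simp add: inv_mult_group m_assoc)
    then show "t \<in> reflections W S"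
      unfolding reflections_def using y s[OF i] by (auto intro!: bexI[of _ "c [^] k \<otimes> y"])
  qed
qed

end
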